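(* Let $S$ be a topological space, $\rho:S\to S_0$ the canonical map onto its $T_0$-reflection, and $\varepsilon:S\to X_{\mathcal{O}S}$ the map $\varepsilon(s)=\{U\in\mathcal{O}S\mid s\in U\}$. The map $\varepsilon$ factors through $\rho$. If $\varepsilon':S_0\to X_{\mathcal{O}S}$ is the induced map (so that $\varepsilon=\varepsilon'\circ\rho$), then the pair $((X_{\mathcal{O}S},\pi),\varepsilon')$ is a compactification of $(S_0,\tau_F)$, where $\tau_F$ is the front topology on $S_0$. In particular, if $S$ is $T_0$, then $((X_{\mathcal{O}S},\pi),\varepsilon)$ is a compactification of $(S,\tau_F)$.
   Context: $\mathcal{O}S$ denotes the frame of open sets of $S$. The Esakia space $X_L$ of a frame $L$ is the set of prime (proper) filters of $L$, ordered by inclusion, with the topology $\pi$ whose basis is $\{\varphi(a)\setminus\varphi(b)\mid a,b\in L\}$, where $\varphi(a)=\{x\in X_L\mid a\in x\}$; $(X_L,\pi)$ is compact Hausdorff. Here $L=\mathcal{O}S$. The $T_0$-reflection $S_0$ of $S$ is the quotient space of $S$ by the equivalence relation $x\sim y$ iff $\overline{\{x\}}=\overline{\{y\}}$; $\rho$ is the quotient map. The front topology $\tau_F$ on a topological space $T$ is the topology generated by $\{U\setminus V\mid U,V\in\mathcal{O}T\}$. A compactification of a space $T$ is a pair $(K,e)$ where $K$ is compact Hausdorff and $e:T\to K$ is a homeomorphism onto its image with $e[T]$ dense in $K$. *)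

theory Defs
  imports "HOL-Analysis.Analysis" "HOL-Algebra.Complete_Lattice"
begin

text \<open>Frees \<open>closure_of\<close> for the topological closure.\<close>

no_notation eq_closure_of (\<open>closure'_of\<index>\<close>)

section \<open>Frames and the frame of open sets\<close>

locale frame = complete_lattice L for L (structure) +
  assumes meet_Sup_distrib:
    "\<lbrakk>a \<in> carrier L; A \<subseteq> carrier L\<rbrakk> \<Longrightarrow> a \<sqinter> (\<Squnion>A) = \<Squnion>((\<lambda>b. a \<sqinter> b) ` A)"

definition opens_frame :: "'a topology \<Rightarrow> 'a set gorder"
  where "opens_frame S = \<lparr>carrier = {U. openin S U}, eq = (=), le = (\<subseteq>)\<rparr>"

lemma opens_frame_sel [simp]:
  "carrier (opens_frame S) = {U. openin S U}"
  "eq (opens_frame S) = (=)"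
  "le (opens_frame S) = (\<subseteq>)"
  by (simp_all add: opens_frame_def)

lemma least_opens_frame_Union:
  assumes "A \<subseteq> {U. openin S U}"
  shows "least (opens_frame S) l (Upper (opens_frame S) A) \<longleftrightarrow> l = \<Union>A"
proof -
  have "openin S (\<Union>A)"
    using assms by blast
  then show ?thesis
    using assms by (auto simp: least_def Upper_def)
qed

lemma greatest_opens_frame_interior:
  assumes "A \<subseteq> {U. openin S U}"
  shows "greatest (opens_frame S) g (Lower (opens_frame S) A)
           \<longleftrightarrow> g = S interior_of (topspace S \<inter> \<Inter>A)"
proof -
  let ?I = "S interior_of (topspace S \<inter> \<Inter>A)"
  have "U \<in> Lower (opens_frame S) A \<longleftrightarrow> openin S U \<and> U \<subseteq> ?I" for U
  proof
    assume "U \<in> Lower (opens_frame S) A"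
    then have U: "openin S U" "\<forall>V\<in>A. U \<subseteq> V"
      using assms by (auto simp: Lower_def)
    then have "U \<subseteq> topspace S \<inter> \<Inter>A"
      using openin_subset[OF U(1)] by (intro Int_greatest Inter_greatest) blast+
    with U(1) show "openin S U \<and> U \<subseteq> ?I"
      by (simp add: interior_of_maximal)
  next
    assume U: "openin S U \<and> U \<subseteq> ?I"
    then have "U \<subseteq> \<Inter>A"
      using interior_of_subset[of S "topspace S \<inter> \<Inter>A"] by blast
    with U show "U \<in> Lower (opens_frame S) A"
      by (auto simp: Lower_def)
  qed
  then have *: "Lower (opens_frame S) A = {U. openin S U \<and> U \<subseteq> ?I}"
    by blast
  show ?thesis
  proof
    assume g: "greatest (opens_frame S) g (Lower (opens_frame S) A)"
    then have "?I \<subseteq> g" "g \<subseteq> ?I"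
      by (simp_all add: greatest_def *)
    then show "g = ?I" by blast
  qed (auto simp: greatest_def *)
qed

lemma opens_frame_Sup:
  "A \<subseteq> {U. openin S U} \<Longrightarrow> \<Squnion>\<^bsub>opens_frame S\<^esub>A = \<Union>A"
  by (simp add: sup_def least_opens_frame_Union)

lemma opens_frame_join:
  "\<lbrakk>openin S U; openin S V\<rbrakk> \<Longrightarrow> U \<squnion>\<^bsub>opens_frame S\<^esub> V = U \<union> V"
  by (simp add: join_def opens_frame_Sup)

lemma opens_frame_meet:
  assumes "openin S U" "openin S V"
  shows "U \<sqinter>\<^bsub>opens_frame S\<^esub> V = U \<inter> V"
proof -
  have "topspace S \<inter> (U \<inter> V) = U \<inter> V" "openin S (U \<inter> V)"
    using assms openin_subset by fastforce+
  then show ?thesis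
    using assms by (simp add: meet_def inf_def greatest_opens_frame_interior interior_of_openin)
qed

lemma frame_opens_frame: "frame (opens_frame S)"
proof -
  interpret complete_lattice "opens_frame S"
    by unfold_locales
       (auto simp: least_opens_frame_Union greatest_opens_frame_interior)
  show ?thesis
  proof unfold_locales
    fix U A
    assume *: "U \<in> carrier (opens_frame S)" "A \<subseteq> carrier (opens_frame S)"
    then have A: "A \<subseteq> {V. openin S V}" and U: "openin S U"
      by simp_all
    then have "openin S (\<Union>A)"
      by blast
    have "(\<lambda>V. U \<sqinter>\<^bsub>opens_frame S\<^esub> V) ` A = (\<lambda>V. U \<inter> V) ` A"
      using U A by (intro image_cong refl opens_frame_meet) blast+
    moreover have "(\<lambda>V. U \<inter> V) ` A \<subseteq> {V. openin S V}"
      using U A by blast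
    ultimately have "\<Squnion>\<^bsub>opens_frame S\<^esub>((\<lambda>V. U \<sqinter>\<^bsub>opens_frame S\<^esub> V) ` A) = (\<Union>V\<in>A. U \<inter> V)"
      by (simp only: opens_frame_Sup)
    moreover have "U \<sqinter>\<^bsub>opens_frame S\<^esub> (\<Squnion>\<^bsub>opens_frame S\<^esub>A) = U \<inter> \<Union>A"
      using U \<open>openin S (\<Union>A)\<close> by (simp only: opens_frame_Sup[OF A] opens_frame_meet)
    ultimately show "U \<sqinter>\<^bsub>opens_frame S\<^esub> (\<Squnion>\<^bsub>opens_frame S\<^esub>A)
        = \<Squnion>\<^bsub>opens_frame S\<^esub>((\<lambda>V. U \<sqinter>\<^bsub>opens_frame S\<^esub> V) ` A)"
      by (simp only: Int_Union)
  qed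
qed

section \<open>The Esakia space of a frame\<close>

definition prime_filters :: "('a, 'b) gorder_scheme \<Rightarrow> 'a set set"
  where "prime_filters L =
    {x. x \<subseteq> carrier L \<and> x \<noteq> {} \<and> x \<noteq> carrier L
      \<and> (\<forall>a\<in>x. \<forall>b\<in>carrier L. a \<sqsubseteq>\<^bsub>L\<^esub> b \<longrightarrow> b \<in> x)
      \<and> (\<forall>a\<in>x. \<forall>b\<in>x. a \<sqinter>\<^bsub>L\<^esub> b \<in> x)
      \<and> (\<forall>a\<in>carrier L. \<forall>b\<in>carrier L. a \<squnion>\<^bsub>L\<^esub> b \<in> x \<longrightarrow> a \<in> x \<or> b \<in> x)}"

definition esakia_phi :: "('a, 'b) gorder_scheme \<Rightarrow> 'a \<Rightarrow> 'a set set"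
  where "esakia_phi L a = {x \<in> prime_filters L. a \<in> x}"

text \<open>The points of \<open>esakia_space L\<close> are the prime filters of \<open>L\<close> and its topology is \<open>\<pi>\<close>.
  The order of the Esakia space is the inclusion order \<open>(\<subseteq>)\<close> on \<open>prime_filters L\<close>; it is not
  bundled.  That the generating family really is a basis is \<open>frame.openin_esakia_space\<close>.\<close>

definition esakia_space :: "('a, 'b) gorder_scheme \<Rightarrow> 'a set topology"
  where "esakia_space L = topology_generated_by
    {esakia_phi L a - esakia_phi L b | a b. a \<in> carrier L \<and> b \<in> carrier L}"

lemma generate_topology_on_Int_closed:
  assumes "generate_topology_on G W"
    and "\<And>A B. \<lbrakk>A \<in> G; B \<in> G\<rbrakk> \<Longrightarrow> A \<inter> B \<in> G"
  shows "\<exists>\<B> \<subseteq> G. W = \<Union>\<B>"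
  using assms(1)
proof induction
  case Empty
  show ?case by (rule exI[of _ "{}"]) simp
next
  case (Int A B)
  then obtain \<A> \<B> where *: "\<A> \<subseteq> G" "A = \<Union>\<A>" "\<B> \<subseteq> G" "B = \<Union>\<B>"
    by (elim exE conjE)
  let ?C = "(\<lambda>(U, V). U \<inter> V) ` (\<A> \<times> \<B>)"
  have "?C \<subseteq> G"
    using assms(2) *(1,3) by auto
  moreover have "A \<inter> B = \<Union>?C"
    using *(2,4) by auto
  ultimately show ?case by blast
next
  case (UN K)
  let ?C = "{B \<in> G. B \<subseteq> \<Union>K}"
  have "\<Union>K \<subseteq> \<Union>?C"
  proof
    fix x assume "x \<in> \<Union>K"
    then obtain k where k: "k \<in> K" "x \<in> k" ..
    then obtain \<B> where \<B>: "\<B> \<subseteq> G" "k = \<Union>\<B>"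
      using UN by metis
    then obtain B where "B \<in> \<B>" "x \<in> B"
      using k(2) by blast
    then show "x \<in> \<Union>?C"
      using k(1) \<B> by (auto intro!: exI[of _ B])
  qed
  then have "\<Union>K = \<Union>?C" by blast
  then show ?case by (intro exI[of _ ?C]) simp
next
  case (Basis s)
  then show ?case by (intro exI[of _ "{s}"]) simp
qed

context frame
begin

lemma top_in_prime_filter:
  assumes "x \<in> prime_filters L"
  shows "\<top> \<in> x"
proof -
  have "x \<noteq> {}" "x \<subseteq> carrier L"
    using assms by (simp_all add: prime_filters_def)
  then obtain a where "a \<in> x" "a \<in> carrier L"
    by blast
  with assms show ?thesis
    using top_higher[of a] by (simp add: prime_filters_def)
qed

lemma bottom_notin_prime_filter:
  assumes "x \<in> prime_filters L"
  shows "\<bottom> \<notin> x"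
proof
  assume "\<bottom> \<in> x"
  with assms have "carrier L \<subseteq> x"
    using bottom_lower by (auto simp: prime_filters_def)
  with assms show False
    by (auto simp: prime_filters_def)
qed

lemma topspace_esakia_space: "topspace (esakia_space L) = prime_filters L"
proof -
  have "esakia_phi L \<top> - esakia_phi L \<bottom> = prime_filters L"
    using top_in_prime_filter bottom_notin_prime_filter by (auto simp: esakia_phi_def)
  then show ?thesis
    unfolding esakia_space_def topology_generated_by_topspace
    using top_closed bottom_closed by (fastforce simp: esakia_phi_def)
qed

lemma esakia_phi_meet:
  assumes "a \<in> carrier L" "b \<in> carrier L"
  shows "esakia_phi L (a \<sqinter> b) = esakia_phi L a \<inter> esakia_phi L b"
proof -
  have "a \<sqinter> b \<in> x \<longleftrightarrow> a \<in> x \<and> b \<in> x" if "x \<in> prime_filters L" for x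
  proof -
    have up: "\<And>c d. \<lbrakk>c \<in> x; d \<in> carrier L; c \<sqsubseteq> d\<rbrakk> \<Longrightarrow> d \<in> x"
      and cl: "\<And>c d. \<lbrakk>c \<in> x; d \<in> x\<rbrakk> \<Longrightarrow> c \<sqinter> d \<in> x"
      using that by (simp_all add: prime_filters_def)
    show ?thesis
      using up[OF _ assms(1) meet_left[OF assms]] up[OF _ assms(2) meet_right[OF assms]] cl
      by blast
  qed
  then show ?thesis
    unfolding esakia_phi_def by blast
qed

lemma esakia_phi_join:
  assumes "a \<in> carrier L" "b \<in> carrier L"
  shows "esakia_phi L (a \<squnion> b) = esakia_phi L a \<union> esakia_phi L b"
proof -
  have "a \<squnion> b \<in> x \<longleftrightarrow> a \<in> x \<or> b \<in> x" if "x \<in> prime_filters L" for x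
  proof -
    have up: "\<And>c d. \<lbrakk>c \<in> x; d \<in> carrier L; c \<sqsubseteq> d\<rbrakk> \<Longrightarrow> d \<in> x"
      and pr: "a \<squnion> b \<in> x \<Longrightarrow> a \<in> x \<or> b \<in> x"
      using that assms by (simp_all add: prime_filters_def)
    show ?thesis
      using up[OF _ join_closed[OF assms] join_left[OF assms]]
        up[OF _ join_closed[OF assms] join_right[OF assms]] pr
      by blast
  qed
  then show ?thesis
    unfolding esakia_phi_def by blast
qed

lemma openin_esakia_space:
  "openin (esakia_space L) W \<longleftrightarrow>
     (\<exists>\<B> \<subseteq> {esakia_phi L a - esakia_phi L b | a b. a \<in> carrier L \<and> b \<in> carrier L}. W = \<Union>\<B>)"
  (is "_ \<longleftrightarrow> (\<exists>\<B> \<subseteq> ?G. W = \<Union>\<B>)")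
proof
  have inter: "A \<inter> B \<in> ?G" if "A \<in> ?G" "B \<in> ?G" for A B
  proof -
    obtain a b c d where *: "a \<in> carrier L" "b \<in> carrier L" "c \<in> carrier L" "d \<in> carrier L"
      "A = esakia_phi L a - esakia_phi L b" "B = esakia_phi L c - esakia_phi L d"
      using \<open>A \<in> ?G\<close> \<open>B \<in> ?G\<close> by blast
    then have "A \<inter> B = esakia_phi L (a \<sqinter> c) - esakia_phi L (b \<squnion> d)"
      by (auto simp: esakia_phi_meet esakia_phi_join)
    moreover have "a \<sqinter> c \<in> carrier L" "b \<squnion> d \<in> carrier L"
      using * by simp_all
    ultimately show ?thesis
      by blast
  qed
  assume "openin (esakia_space L) W"
  then show "\<exists>\<B> \<subseteq> ?G. W = \<Union>\<B>"
    unfolding esakia_space_def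
    by (intro generate_topology_on_Int_closed inter openin_topology_generated_by)
next
  assume "\<exists>\<B> \<subseteq> ?G. W = \<Union>\<B>"
  then obtain \<B> where \<B>: "\<B> \<subseteq> ?G" "W = \<Union>\<B>"
    by (elim exE conjE)
  have "openin (esakia_space L) B" if "B \<in> \<B>" for B
    unfolding esakia_space_def
    by (rule topology_generated_by_Basis[OF subsetD[OF \<B>(1) that]])
  then show "openin (esakia_space L) W"
    unfolding \<B>(2) by (rule openin_Union)
qed

end

section \<open>The \<open>T\<^sub>0\<close>-reflection\<close>

definition quotient_topology :: "'a topology \<Rightarrow> 'a rel \<Rightarrow> 'a set topology"
  where "quotient_topology S R = topology
    (\<lambda>W. W \<subseteq> topspace S // R \<and> openin S {x \<in> topspace S. R `` {x} \<in> W})"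

lemma openin_quotient_topology:
  "openin (quotient_topology S R) W \<longleftrightarrow>
     W \<subseteq> topspace S // R \<and> openin S {x \<in> topspace S. R `` {x} \<in> W}"
proof -
  have "{x \<in> topspace S. R `` {x} \<in> V \<inter> W}
      = {x \<in> topspace S. R `` {x} \<in> V} \<inter> {x \<in> topspace S. R `` {x} \<in> W}"
    "{x \<in> topspace S. R `` {x} \<in> \<Union>\<W>} = (\<Union>W\<in>\<W>. {x \<in> topspace S. R `` {x} \<in> W})"
    for V W \<W>
    by auto
  then have "istopology (\<lambda>W. W \<subseteq> topspace S // R \<and> openin S {x \<in> topspace S. R `` {x} \<in> W})"
    unfolding istopology_def by (auto intro!: openin_Union)
  then show ?thesis
    by (simp add: quotient_topology_def topology_inverse')
qed

lemma topspace_quotient_topology: "topspace (quotient_topology S R) = topspace S // R"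
proof
  have "{x \<in> topspace S. R `` {x} \<in> topspace S // R} = topspace S"
    by (auto intro: quotientI)
  then have "openin (quotient_topology S R) (topspace S // R)"
    by (simp add: openin_quotient_topology)
  then show "topspace S // R \<subseteq> topspace (quotient_topology S R)"
    by (rule openin_subset)
next
  show "topspace (quotient_topology S R) \<subseteq> topspace S // R"
    using openin_topspace[of "quotient_topology S R"] by (simp only: openin_quotient_topology)
qed

definition T0_rel :: "'a topology \<Rightarrow> 'a rel"
  where "T0_rel S =
    {(x, y). x \<in> topspace S \<and> y \<in> topspace S \<and> S closure_of {x} = S closure_of {y}}"

lemma equiv_T0_rel: "equiv (topspace S) (T0_rel S)"
  by (auto simp: equiv_def refl_on_def sym_def trans_def T0_rel_def)

definition T0_reflection :: "'a topology \<Rightarrow> 'a set topology"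
  where "T0_reflection S = quotient_topology S (T0_rel S)"

definition T0_map :: "'a topology \<Rightarrow> 'a \<Rightarrow> 'a set"
  where "T0_map S s = T0_rel S `` {s}"

lemma quotient_map_T0_map: "quotient_map S (T0_reflection S) (T0_map S)"
proof -
  have "T0_map S ` topspace S = topspace S // T0_rel S"
    by (auto simp: quotient_def T0_map_def)
  then show ?thesis
    by (simp add: quotient_map_def T0_reflection_def T0_map_def topspace_quotient_topology
        openin_quotient_topology)
qed

section \<open>Front topology and compactifications\<close>

definition front_topology :: "'a topology \<Rightarrow> 'a topology"
  where "front_topology T = topology_generated_by {U - V | U V. openin T U \<and> openin T V}"

lemma topspace_front_topology: "topspace (front_topology T) = topspace T"
proof -
  let ?G = "{U - V | U V. openin T U \<and> openin T V}"
  have "topspace T - {} \<in> ?G"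
    by (rule CollectI, rule exI[of _ "topspace T"], rule exI[of _ "{}"]) simp
  then have "topspace T \<subseteq> \<Union>?G"
    unfolding Diff_empty by (rule Union_upper)
  moreover have "\<Union>?G \<subseteq> topspace T"
  proof (rule Union_least)
    fix W assume "W \<in> ?G"
    then obtain U V where "W = U - V" "openin T U"
      by (elim CollectE exE conjE)
    then show "W \<subseteq> topspace T"
      using openin_subset[of T U] by (simp add: subset_iff)
  qed
  ultimately show ?thesis
    unfolding front_topology_def topology_generated_by_topspace by (rule antisym[rotated])
qed

definition is_compactification :: "'a topology \<Rightarrow> 'b topology \<Rightarrow> ('a \<Rightarrow> 'b) \<Rightarrow> bool"
  where "is_compactification T K e \<longleftrightarrow>
    compact_space K \<and> Hausdorff_space K \<and> embedding_map T K e \<and>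
    K closure_of (e ` topspace T) = topspace K"

section \<open>The map \<open>\<epsilon>\<close>\<close>

definition esakia_eps :: "'a topology \<Rightarrow> 'a \<Rightarrow> 'a set set"
  where "esakia_eps S s = {U. openin S U \<and> s \<in> U}"

end

theory Submission
  imports Defs
begin

text \<open>
  The prime filters of \<open>L\<close>, identified with their characteristic functions, form a closed set in the
  Cantor cube \<open>2\<^sup>L\<close>, because each defining condition involves only finitely many coordinates; so
  \<open>\<pi>\<close> is compact by Tychonoff's theorem, without any prime ideal theorem. It is Hausdorff
  because every \<open>\<phi>(a)\<close> is clopen. The map \<open>\<epsilon>\<close> pulls \<open>\<phi>(U) \<setminus> \<phi>(V)\<close> back to \<open>U \<setminus> V\<close>,
  which is nonempty whenever \<open>\<phi>(U) \<setminus> \<phi>(V)\<close> is; hence the image is dense and \<open>\<epsilon>\<close> is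
  an embedding of the front topology once points with equal images have been identified.
\<close>

section \<open>Compactness and separation of the Esakia space\<close>

context frame
begin

lemma openin_esakia_phi_Diff:
  "\<lbrakk>a \<in> carrier L; b \<in> carrier L\<rbrakk> \<Longrightarrow> openin (esakia_space L) (esakia_phi L a - esakia_phi L b)"
  unfolding esakia_space_def by (rule topology_generated_by_Basis) blast

lemma openin_esakia_phi:
  assumes "a \<in> carrier L"
  shows "openin (esakia_space L) (esakia_phi L a)"
proof -
  have "esakia_phi L \<bottom> = {}"
    using bottom_notin_prime_filter by (auto simp: esakia_phi_def)
  then show ?thesis
    using openin_esakia_phi_Diff[OF assms bottom_closed] by simp
qed

lemma closedin_esakia_phi:
  assumes "a \<in> carrier L"
  shows "closedin (esakia_space L) (esakia_phi L a)"
proof -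
  have "esakia_phi L \<top> = topspace (esakia_space L)"
    using top_in_prime_filter by (auto simp: esakia_phi_def topspace_esakia_space)
  then show ?thesis
    using openin_esakia_phi_Diff[OF top_closed assms]
    by (auto simp: closedin_def esakia_phi_def topspace_esakia_space)
qed

lemma Hausdorff_esakia_space: "Hausdorff_space (esakia_space L)"
  unfolding Hausdorff_space_def
proof (intro allI impI, elim conjE)
  have sep: "\<exists>U V. openin (esakia_space L) U \<and> openin (esakia_space L) V
      \<and> x \<in> U \<and> y \<in> V \<and> disjnt U V"
    if "x \<in> prime_filters L" "y \<in> prime_filters L" "a \<in> x" "a \<notin> y" for x y a
  proof -
    have "a \<in> carrier L"
      using that by (auto simp: prime_filters_def)
    then have "openin (esakia_space L) (esakia_phi L a)"
      "openin (esakia_space L) (topspace (esakia_space L) - esakia_phi L a)"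
      using openin_esakia_phi closedin_esakia_phi by (auto simp: closedin_def)
    moreover have "x \<in> esakia_phi L a" "y \<in> topspace (esakia_space L) - esakia_phi L a"
      using that by (auto simp: esakia_phi_def topspace_esakia_space)
    ultimately show ?thesis
      by (metis DiffD2 disjnt_iff)
  qed
  fix x y
  assume "x \<in> topspace (esakia_space L)" "y \<in> topspace (esakia_space L)" "x \<noteq> y"
  then have xy: "x \<in> prime_filters L" "y \<in> prime_filters L"
    by (simp_all add: topspace_esakia_space)
  from \<open>x \<noteq> y\<close> consider a where "a \<in> x" "a \<notin> y" | a where "a \<in> y" "a \<notin> x"
    by blast
  then show "\<exists>U V. openin (esakia_space L) U \<and> openin (esakia_space L) V
      \<and> x \<in> U \<and> y \<in> V \<and> disjnt U V"
  proof cases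
    case 1
    then show ?thesis
      using sep xy by blast
  next
    case 2
    then show ?thesis
      using sep[OF xy(2,1)] by (metis disjnt_sym)
  qed
qed

text \<open>Nonemptiness and properness become conditions on \<open>\<top>\<close> and
  \<open>\<bottom>\<close>, and every other clause concerns fixed elements of \<open>L\<close>. Each
  condition then tests finitely many coordinates, so closedness in the cube can be read off.\<close>

lemma prime_filters_iff:
  "x \<in> prime_filters L \<longleftrightarrow> x \<subseteq> carrier L \<and> \<top> \<in> x \<and> \<bottom> \<notin> x
      \<and> (\<forall>a\<in>carrier L. \<forall>b\<in>carrier L. a \<sqsubseteq> b \<longrightarrow> a \<in> x \<longrightarrow> b \<in> x)
      \<and> (\<forall>a\<in>carrier L. \<forall>b\<in>carrier L. a \<in> x \<and> b \<in> x \<longrightarrow> a \<sqinter> b \<in> x)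
      \<and> (\<forall>a\<in>carrier L. \<forall>b\<in>carrier L. a \<squnion> b \<in> x \<longrightarrow> a \<in> x \<or> b \<in> x)"
  (is "_ \<longleftrightarrow> ?R")
proof
  assume x: "x \<in> prime_filters L"
  then show ?R
    using top_in_prime_filter[OF x] bottom_notin_prime_filter[OF x]
    by (simp add: prime_filters_def)
next
  assume ?R
  then have sub: "x \<subseteq> carrier L" and bounds: "\<top> \<in> x" "\<bottom> \<notin> x"
    and up: "\<And>a b. \<lbrakk>a \<in> carrier L; b \<in> carrier L; a \<sqsubseteq> b; a \<in> x\<rbrakk> \<Longrightarrow> b \<in> x"
    and meet: "\<And>a b. \<lbrakk>a \<in> carrier L; b \<in> carrier L; a \<in> x; b \<in> x\<rbrakk> \<Longrightarrow> a \<sqinter> b \<in> x"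
    and prime: "\<And>a b. \<lbrakk>a \<in> carrier L; b \<in> carrier L; a \<squnion> b \<in> x\<rbrakk> \<Longrightarrow> a \<in> x \<or> b \<in> x"
    by simp_all
  have "x \<noteq> {}" "x \<noteq> carrier L"
    using bounds bottom_closed by blast+
  then show "x \<in> prime_filters L"
    unfolding prime_filters_def using sub up[OF subsetD[OF sub]] meet[OF subsetD[OF sub] subsetD[OF sub]] prime
    by (intro CollectI conjI ballI impI)
qed

lemma compact_space_esakia_space: "compact_space (esakia_space L)"
proof -
  \<comment> \<open>The cube is indexed by the whole type \<open>'a\<close>, with the product
    topology on \<open>'a \<Rightarrow> bool\<close>; lying inside \<open>carrier L\<close> is one
    of the closed conditions.\<close>
  let ?C = "{p. Collect p \<in> prime_filters L}"
  have coord: "open {p. p a}" "closed {p. p a}" "open {p. \<not> p a}" "closed {p. \<not> p a}"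
    for a :: 'a
  proof -
    have *: "continuous_on UNIV (\<lambda>p :: 'a \<Rightarrow> bool. p a)"
      by (rule continuous_on_product_coordinates)
    have "open ((\<lambda>p :: 'a \<Rightarrow> bool. p a) -` {True})" "open ((\<lambda>p :: 'a \<Rightarrow> bool. p a) -` {False})"
      using * by (auto intro!: open_vimage open_discrete)
    then show "open {p. p a}" "open {p. \<not> p a}"
      by (simp_all add: vimage_def)
    then show "closed {p. p a}" "closed {p. \<not> p a}"
      by (simp_all add: closed_def Collect_neg_eq[symmetric])
  qed
  have "closed ?C"
    \<comment> \<open>An implication between an open premise and a closed conclusion defines a
      closed set; this is where coordinates must be both open and closed. Universal quantifiers give
      intersections.\<close>
    unfolding prime_filters_iff subset_iff mem_Collect_eq Ball_def
    by (intro closed_Collect_conj closed_Collect_all closed_Collect_imp closed_Collect_disj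
        open_Collect_conj coord closed_Collect_const open_Collect_const)
  moreover have "compact (UNIV :: ('a \<Rightarrow> bool) set)"
  proof -
    have "compact_space (euclidean :: bool topology)"
      by (simp add: compact_space_def finite_imp_compact)
    then have "compact_space (product_topology (\<lambda>_::'a. euclidean :: bool topology) UNIV)"
      by (simp add: compact_space_product_topology)
    then show ?thesis
      by (simp add: euclidean_product_topology compact_space_def)
  qed
  ultimately have C: "compact ?C"
    using compact_Int_closed[of UNIV ?C] by simp
  \<comment> \<open>Compactness passes along the surjection \<open>Collect\<close>; the preimage of
    a generator depends on the two coordinates \<open>a\<close> and \<open>b\<close> only.\<close>
  have "continuous_map (top_of_set ?C) (esakia_space L) Collect"
    unfolding esakia_space_def
  proof (rule continuous_on_generated_topo)
    fix U assume "U \<in> {esakia_phi L a - esakia_phi L b |a b. a \<in> carrier L \<and> b \<in> carrier L}"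
    then obtain a b where "U = esakia_phi L a - esakia_phi L b"
      by blast
    then have "Collect -` U \<inter> topspace (top_of_set ?C) = ?C \<inter> {p. p a \<and> \<not> p b}"
      by (auto simp: esakia_phi_def)
    then show "openin (top_of_set ?C) (Collect -` U \<inter> topspace (top_of_set ?C))"
      by (simp only: openin_open_Int open_Collect_conj coord)
  next
    show "Collect ` topspace (top_of_set ?C)
        \<subseteq> \<Union>{esakia_phi L a - esakia_phi L b |a b. a \<in> carrier L \<and> b \<in> carrier L}"
      using topspace_esakia_space
      unfolding esakia_space_def topology_generated_by_topspace by auto
  qed
  then have "compactin (esakia_space L) (Collect ` ?C)"
    using C by (intro image_compactin[of "top_of_set ?C"]) (simp_all add: compactin_subtopology)
  moreover have "Collect ` ?C = topspace (esakia_space L)"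
    by (force simp: topspace_esakia_space intro: image_eqI[of _ _ "\<lambda>a. a \<in> _"])
  ultimately show ?thesis
    by (simp add: compact_space_def)
qed

end

section \<open>The map into the Esakia space\<close>

text \<open>Finite meets and joins of opens are intersections and unions, so each filter condition
  becomes a statement about where \<open>s\<close> lies; \<open>topspace S\<close> and
  \<open>{}\<close> witness nonemptiness and properness.\<close>

lemma esakia_eps_in_prime_filters:
  assumes "s \<in> topspace S"
  shows "esakia_eps S s \<in> prime_filters (opens_frame S)"
proof -
  have "topspace S \<in> esakia_eps S s" "{} \<notin> esakia_eps S s" "{} \<in> {U. openin S U}"
    using assms by (simp_all add: esakia_eps_def)
  then have "esakia_eps S s \<noteq> {}" and "esakia_eps S s \<noteq> {U. openin S U}"
    by (metis empty_iff, metis)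
  then show ?thesis
    by (auto simp: prime_filters_def opens_frame_meet opens_frame_join esakia_eps_def)
qed

text \<open>Density and the embedding both rest on this pullback formula.\<close>

lemma esakia_eps_in_esakia_phi_iff:
  assumes "s \<in> topspace S" "openin S U"
  shows "esakia_eps S s \<in> esakia_phi (opens_frame S) U \<longleftrightarrow> s \<in> U"
proof -
  have "U \<in> esakia_eps S s \<longleftrightarrow> s \<in> U"
    using assms(2) by (simp add: esakia_eps_def)
  then show ?thesis
    using esakia_eps_in_prime_filters[OF assms(1)] by (simp add: esakia_phi_def)
qed

lemma topspace_esakia_opens_frame:
  "topspace (esakia_space (opens_frame S)) = prime_filters (opens_frame S)"
  by (rule frame.topspace_esakia_space[OF frame_opens_frame])

lemma esakia_eps_dense:
  "esakia_space (opens_frame S) closure_of (esakia_eps S ` topspace S)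
     = topspace (esakia_space (opens_frame S))"
  unfolding dense_intersects_open
proof (intro allI impI, elim conjE)
  fix W assume W: "openin (esakia_space (opens_frame S)) W" "W \<noteq> {}"
  let ?G = "{esakia_phi (opens_frame S) U - esakia_phi (opens_frame S) V |U V.
      U \<in> carrier (opens_frame S) \<and> V \<in> carrier (opens_frame S)}"
  obtain \<B> where \<B>: "\<B> \<subseteq> ?G" "W = \<Union>\<B>"
    using W(1) unfolding frame.openin_esakia_space[OF frame_opens_frame] by (elim exE conjE)
  obtain x B where B: "B \<in> \<B>" "x \<in> B"
    using W(2) \<B>(2) by blast
  then have "B \<in> ?G" "B \<subseteq> W"
    using \<B> by blast+
  then obtain U V where UV: "openin S U" "openin S V"
    and B_eq: "B = esakia_phi (opens_frame S) U - esakia_phi (opens_frame S) V"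
    by auto
  have x: "x \<in> prime_filters (opens_frame S)" "U \<in> x" "V \<notin> x"
    using B(2) unfolding B_eq esakia_phi_def by blast+
  \<comment> \<open>Otherwise upward closure of \<open>x\<close> would put \<open>V\<close> into
    \<open>x\<close>.\<close>
  have "\<not> U \<subseteq> V"
    using x UV by (auto simp: prime_filters_def)
  then obtain s where s: "s \<in> U" "s \<notin> V"
    by blast
  then have "s \<in> topspace S"
    using UV openin_subset by blast
  then have "esakia_eps S s \<in> B"
    using s UV by (simp add: B_eq esakia_eps_in_esakia_phi_iff)
  then show "esakia_eps S ` topspace S \<inter> W \<noteq> {}"
    using \<open>B \<subseteq> W\<close> \<open>s \<in> topspace S\<close> by blast
qed

section \<open>Embedding the front topology\<close>

text \<open>Differences of opens are closed under binary intersection, so they form a basis and not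
  just a subbasis. Images commute with unions, so checking basic sets suffices.\<close>

lemma front_topology_open_map:
  assumes "\<And>U V. \<lbrakk>openin T U; openin T V\<rbrakk> \<Longrightarrow> openin Y (f ` (U - V))"
  shows "open_map (front_topology T) Y f"
  unfolding open_map_def
proof (intro allI impI)
  let ?G = "{U - V | U V. openin T U \<and> openin T V}"
  fix W assume W: "openin (front_topology T) W"
  have "A \<inter> B \<in> ?G" if AB: "A \<in> ?G" "B \<in> ?G" for A B
  proof -
    obtain U V where UV: "A = U - V" "openin T U" "openin T V"
      using AB(1) by (elim CollectE exE conjE)
    obtain U' V' where UV': "B = U' - V'" "openin T U'" "openin T V'"
      using AB(2) by (elim CollectE exE conjE)
    have "A \<inter> B = (U \<inter> U') - (V \<union> V')"
      unfolding UV(1) UV'(1) by blast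
    moreover have "openin T (U \<inter> U')" "openin T (V \<union> V')"
      using UV UV' by (simp_all add: openin_Int openin_Un)
    ultimately show ?thesis
      by (intro CollectI exI conjI)
  qed
  moreover have "generate_topology_on ?G W"
    using W by (simp add: front_topology_def openin_topology_generated_by)
  ultimately have "\<exists>\<B>\<subseteq>?G. W = \<Union>\<B>"
    by (intro generate_topology_on_Int_closed)
  then obtain \<B> where \<B>: "\<B> \<subseteq> ?G" "W = \<Union>\<B>"
    by (elim exE conjE)
  have "openin Y (f ` B)" if "B \<in> \<B>" for B
  proof -
    have "B \<in> ?G"
      using \<B>(1) that by (rule subsetD)
    then show ?thesis
      using assms by (elim CollectE exE conjE) simp
  qed
  then show "openin Y (f ` W)"
    unfolding \<B>(2) image_Union by (intro openin_Union) blast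
qed

text \<open>Stated for any space \<open>T\<close> in place of the \<open>T\<^sub>0\<close>-reflection, so that it also covers
  \<open>g = id\<close> for a \<open>T\<^sub>0\<close> space.\<close>

lemma is_compactification_esakia_space:
  assumes surj: "g ` topspace S = topspace T"
    and opens: "\<And>U. openin S U \<longleftrightarrow> (\<exists>W. openin T W \<and> U = {s \<in> topspace S. g s \<in> W})"
    and inj: "\<And>s t. \<lbrakk>s \<in> topspace S; t \<in> topspace S; esakia_eps S s = esakia_eps S t\<rbrakk> \<Longrightarrow> g s = g t"
    and e: "\<And>s. s \<in> topspace S \<Longrightarrow> e (g s) = esakia_eps S s"
  shows "is_compactification (front_topology T) (esakia_space (opens_frame S)) e"
proof -
  let ?L = "opens_frame S" and ?E = "esakia_space (opens_frame S)"
  interpret frame ?L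
    by (rule frame_opens_frame)
  have img: "e ` topspace T = esakia_eps S ` topspace S"
    unfolding surj[symmetric] image_image by (rule image_cong) (simp_all add: e)
  have prim: "e t \<in> prime_filters ?L" if "t \<in> topspace T" for t
  proof -
    obtain s where "s \<in> topspace S" "t = g s"
      using \<open>t \<in> topspace T\<close> surj by blast
    then show ?thesis
      by (simp add: e esakia_eps_in_prime_filters)
  qed
  have preimage: "openin S {s \<in> topspace S. g s \<in> W}" if "openin T W" for W
    using that by (intro opens[THEN iffD2] exI[of _ W]) simp
  \<comment> \<open>Every point of \<open>T\<close> has the form \<open>g s\<close>, which reduces
    this to the pullback formula for \<open>\<epsilon>\<close>. It yields both continuity and
    openness of \<open>e\<close>.\<close>
  have phi: "e -` esakia_phi ?L {s \<in> topspace S. g s \<in> W} \<inter> topspace T = W"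
    if W: "openin T W" for W
  proof -
    have "e t \<in> esakia_phi ?L {s \<in> topspace S. g s \<in> W} \<longleftrightarrow> t \<in> W" if "t \<in> topspace T" for t
    proof -
      obtain s where s: "s \<in> topspace S" "t = g s"
        using \<open>t \<in> topspace T\<close> surj by blast
      then show ?thesis
        using preimage[OF W] by (simp add: e esakia_eps_in_esakia_phi_iff)
    qed
    then show ?thesis
      using openin_subset[OF W] by (auto simp only: vimage_eq Int_iff subset_iff)
  qed
  have "continuous_map (front_topology T) ?E e"
    unfolding esakia_space_def
  proof (rule continuous_on_generated_topo)
    fix A assume "A \<in> {esakia_phi ?L U - esakia_phi ?L V |U V. U \<in> carrier ?L \<and> V \<in> carrier ?L}"
    then obtain U V where UV: "openin S U" "openin S V" "A = esakia_phi ?L U - esakia_phi ?L V"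
      by auto
    obtain U' where U': "openin T U'" "U = {s \<in> topspace S. g s \<in> U'}"
      using UV(1) unfolding opens[of U] by (elim exE conjE)
    obtain V' where V': "openin T V'" "V = {s \<in> topspace S. g s \<in> V'}"
      using UV(2) unfolding opens[of V] by (elim exE conjE)
    have "e -` A \<inter> topspace (front_topology T) = U' - V'"
      using phi[OF U'(1)] phi[OF V'(1)]
      unfolding UV(3) U'(2) V'(2) topspace_front_topology vimage_Diff by blast
    moreover have "openin (front_topology T) (U' - V')"
      unfolding front_topology_def
      by (rule topology_generated_by_Basis) (use U'(1) V'(1) in blast)
    ultimately show "openin (front_topology T) (e -` A \<inter> topspace (front_topology T))"
      by simp
  next
    show "e ` topspace (front_topology T)
        \<subseteq> \<Union>{esakia_phi ?L U - esakia_phi ?L V |U V. U \<in> carrier ?L \<and> V \<in> carrier ?L}"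
      using prim topspace_esakia_space
      unfolding esakia_space_def topology_generated_by_topspace
      by (auto simp: topspace_front_topology)
  qed
  moreover have "open_map (front_topology T) (subtopology ?E (e ` topspace T)) e"
  proof (rule front_topology_open_map)
    fix U V assume UV: "openin T U" "openin T V"
    let ?p = "\<lambda>W. {s \<in> topspace S. g s \<in> W}"
    have "e ` (U - V) = (esakia_phi ?L (?p U) - esakia_phi ?L (?p V)) \<inter> e ` topspace T"
    proof -
      \<comment> \<open>The image of a preimage is the intersection with the range. With
        \<open>phi\<close>, the image of a basic front-open set is thus the trace of a basic set of
        \<open>\<pi>\<close>.\<close>
      have *: "e ` (e -` P \<inter> X - e -` Q \<inter> X) = (P - Q) \<inter> e ` X" for P Q X
        by blast
      show ?thesis
        using *[of "esakia_phi ?L (?p U)" "topspace T" "esakia_phi ?L (?p V)"]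
        unfolding phi[OF UV(1)] phi[OF UV(2)] .
    qed
    moreover have "openin ?E (esakia_phi ?L (?p U) - esakia_phi ?L (?p V))"
      using UV by (intro openin_esakia_phi_Diff) (simp_all add: preimage)
    ultimately show "openin (subtopology ?E (e ` topspace T)) (e ` (U - V))"
      unfolding openin_subtopology by blast
  qed
  moreover have "inj_on e (topspace T)"
    unfolding surj[symmetric]
  proof (rule inj_onI, elim imageE)
    fix x y s t
    assume "e x = e y" "x = g s" "y = g t" "s \<in> topspace S" "t \<in> topspace S"
    then show "x = y"
      using inj[of s t] by (simp add: e)
  qed
  moreover have "e ` topspace T \<subseteq> topspace ?E"
    using prim by (auto simp: topspace_esakia_space)
  ultimately have "embedding_map (front_topology T) ?E e"
    unfolding embedding_map_def topspace_front_topology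
    by (intro bijective_open_imp_homeomorphic_map)
       (auto simp: continuous_map_in_subtopology topspace_front_topology)
  then show ?thesis
    unfolding is_compactification_def topspace_front_topology img
    by (intro conjI compact_space_esakia_space Hausdorff_esakia_space esakia_eps_dense)
qed

section \<open>Passage to the \<open>T\<^sub>0\<close>-reflection\<close>

text \<open>Two points have the same closure iff each lies in the closure of the other, that is, iff
  they lie in the same open sets. Hence \<open>\<epsilon>\<close> is constant on classes and the
  induced map is injective.\<close>

lemma T0_map_eq_iff:
  assumes "s \<in> topspace S" "t \<in> topspace S"
  shows "T0_map S s = T0_map S t \<longleftrightarrow> esakia_eps S s = esakia_eps S t"
proof -
  have "T0_map S s = T0_map S t \<longleftrightarrow> S closure_of {s} = S closure_of {t}"
    using eq_equiv_class_iff[OF equiv_T0_rel assms] assms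
    by (simp add: T0_map_def T0_rel_def)
  also have "\<dots> \<longleftrightarrow> esakia_eps S s = esakia_eps S t"
  proof
    assume *: "S closure_of {s} = S closure_of {t}"
    have "s \<in> S closure_of {s}" "t \<in> S closure_of {t}"
      using assms by (auto simp: in_closure_of)
    then have "s \<in> S closure_of {t}" "t \<in> S closure_of {s}"
      using * by auto
    then show "esakia_eps S s = esakia_eps S t"
      by (auto simp: esakia_eps_def in_closure_of)
  next
    assume "esakia_eps S s = esakia_eps S t"
    then have "\<And>U. openin S U \<Longrightarrow> s \<in> U \<longleftrightarrow> t \<in> U"
      by (auto simp: esakia_eps_def)
    then show "S closure_of {s} = S closure_of {t}"
      by (auto simp: closure_of_def)
  qed
  finally show ?thesis .
qed

text \<open>Open sets do not distinguish equivalent points, so an open \<open>U\<close> is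
  saturated: it is the preimage of its own image, which is then open in the quotient.\<close>

lemma openin_T0_reflection_preimage:
  "openin S U \<longleftrightarrow> (\<exists>W. openin (T0_reflection S) W \<and> U = {s \<in> topspace S. T0_map S s \<in> W})"
proof
  assume U: "openin S U"
  then have sub: "U \<subseteq> topspace S"
    by (rule openin_subset)
  have "s \<in> U" if "s \<in> topspace S" "t \<in> U" "T0_map S s = T0_map S t" for s t
    using that U sub T0_map_eq_iff[of s S t] by (auto simp: esakia_eps_def)
  then have eq: "U = {s \<in> topspace S. T0_map S s \<in> T0_map S ` U}"
    using sub by blast
  moreover have "openin (T0_reflection S) (T0_map S ` U)"
    using quotient_map_T0_map[of S] U eq sub
    unfolding quotient_map_def by (metis image_mono)
  ultimately show "\<exists>W. openin (T0_reflection S) W \<and> U = {s \<in> topspace S. T0_map S s \<in> W}"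
    by blast
next
  assume "\<exists>W. openin (T0_reflection S) W \<and> U = {s \<in> topspace S. T0_map S s \<in> W}"
  then show "openin S U"
    using quotient_map_T0_map[of S] openin_subset unfolding quotient_map_def by metis
qed

text \<open>Functions are total, so the factorization determines \<open>\<epsilon>'\<close> only on
  the points of the reflection. Hence one such map is shown to exist, and the compactification claim
  is made for all of them.\<close>

theorem lemma7p9:
  fixes S :: "'a topology"
  shows "esakia_eps S \<in> topspace S \<rightarrow> topspace (esakia_space (opens_frame S))
    \<and> (\<exists>\<epsilon>'. \<epsilon>' \<in> topspace (T0_reflection S) \<rightarrow> topspace (esakia_space (opens_frame S))
           \<and> (\<forall>s\<in>topspace S. esakia_eps S s = \<epsilon>' (T0_map S s)))
    \<and> (\<forall>\<epsilon>'. \<epsilon>' \<in> topspace (T0_reflection S) \<rightarrow> topspace (esakia_space (opens_frame S))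
           \<and> (\<forall>s\<in>topspace S. esakia_eps S s = \<epsilon>' (T0_map S s)) \<longrightarrow>
           is_compactification (front_topology (T0_reflection S)) (esakia_space (opens_frame S)) \<epsilon>')
    \<and> (t0_space S \<longrightarrow>
           is_compactification (front_topology S) (esakia_space (opens_frame S)) (esakia_eps S))"
proof (intro conjI allI impI)
  show eps: "esakia_eps S \<in> topspace S \<rightarrow> topspace (esakia_space (opens_frame S))"
    by (simp add: topspace_esakia_opens_frame esakia_eps_in_prime_filters)
  have surj: "T0_map S ` topspace S = topspace (T0_reflection S)"
    by (rule quotient_imp_surjective_map[OF quotient_map_T0_map])
  \<comment> \<open>Evaluates \<open>\<epsilon>\<close> at a chosen representative of the class;
    \<open>T0_map_eq_iff\<close> makes the choice immaterial.\<close>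
  define \<epsilon>' where "\<epsilon>' w = esakia_eps S (inv_into (topspace S) (T0_map S) w)" for w
  have \<epsilon>': "\<epsilon>' (T0_map S s) = esakia_eps S s" if "s \<in> topspace S" for s
  proof -
    have "T0_map S s \<in> T0_map S ` topspace S"
      using that by (rule imageI)
    then show ?thesis
      using that T0_map_eq_iff[OF inv_into_into that] f_inv_into_f
      unfolding \<epsilon>'_def by metis
  qed
  show "\<exists>\<epsilon>'. \<epsilon>' \<in> topspace (T0_reflection S) \<rightarrow> topspace (esakia_space (opens_frame S))
           \<and> (\<forall>s\<in>topspace S. esakia_eps S s = \<epsilon>' (T0_map S s))"
    using \<epsilon>' eps unfolding surj[symmetric] by (intro exI[of _ \<epsilon>']) auto
next
  fix \<epsilon>'
  assume "\<epsilon>' \<in> topspace (T0_reflection S) \<rightarrow> topspace (esakia_space (opens_frame S))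
           \<and> (\<forall>s\<in>topspace S. esakia_eps S s = \<epsilon>' (T0_map S s))"
  then show "is_compactification (front_topology (T0_reflection S)) (esakia_space (opens_frame S)) \<epsilon>'"
    using quotient_imp_surjective_map[OF quotient_map_T0_map]
    by (intro is_compactification_esakia_space[where g = "T0_map S"] openin_T0_reflection_preimage)
       (auto simp: T0_map_eq_iff)
next
  assume "t0_space S"
  \<comment> \<open>For a \<open>T\<^sub>0\<close> space the identity takes the role of the
    reflection map, and the separation axiom supplies the injectivity hypothesis.\<close>
  then have inj: "s = t"
    if "s \<in> topspace S" "t \<in> topspace S" "esakia_eps S s = esakia_eps S t" for s t
    using that unfolding t0_space_def esakia_eps_def set_eq_iff mem_Collect_eq by metis
  have opens: "openin S U \<longleftrightarrow> (\<exists>W. openin S W \<and> U = {s \<in> topspace S. s \<in> W})" for U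
    by (metis Collect_conj_eq Collect_mem_eq inf.absorb_iff2 openin_subset)
  show "is_compactification (front_topology S) (esakia_space (opens_frame S)) (esakia_eps S)"
    by (rule is_compactification_esakia_space[where g = "\<lambda>s. s", OF image_ident opens inj HOL.refl])
qed

end
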